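(* Let $p$ be a prime and let $G$ be $SL_2(\mathbb F_p)$ (respectively $GL_2(\mathbb F_p)$). Suppose that $A\in G$ admits a diagonal Jordan form over $\mathbb F_p$, with eigenvalues $\lambda_1,\lambda_2\in\mathbb F_p$. Then $A$ has a square root in $G$ (i.e. there is $B\in G$ with $B^2=A$) if and only if $\left(\frac{\lambda_1}{p}\right)=1$ and $\left(\frac{\lambda_2}{p}\right)=1$ over $\mathbb F_p$.
   Context: For $a\in\mathbb F_p$, $\left(\frac{a}{p}\right)=1$ means that $a$ is a nonzero square in $\mathbb F_p$.
   Formalization: "Only if" is claimed only for λ1 ≠ λ2; "if" is kept for all λ1, λ2. As stated the claim fails for scalar A: in SL_2(F_3), −I is the square of the matrix with rows (0,1), (−1,0), but −1 is not a square. For λ1 = λ2 a nonsquare it always fails. *)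

theory Defs
  imports "Jordan_Normal_Form.Jordan_Normal_Form" "Berlekamp_Zassenhaus.Finite_Field"
begin

definition SL2 :: "'a :: field mat set" where
  "SL2 = {A \<in> carrier_mat 2 2. det A = 1}"

definition GL2 :: "'a :: field mat set" where
  "GL2 = {A \<in> carrier_mat 2 2. invertible_mat A}"

definition has_square_root_in :: "'a :: field mat set \<Rightarrow> 'a mat \<Rightarrow> bool" where
  "has_square_root_in G A \<longleftrightarrow> (\<exists>B\<in>G. B ^\<^sub>m 2 = A)"

(* For p = CARD('p) this is the condition that the symbol (a / p) equals 1;
   it is also meaningful for p = 2. *)
definition nonzero_square :: "'p :: prime_card mod_ring \<Rightarrow> bool" where
  "nonzero_square a \<longleftrightarrow> a \<noteq> 0 \<and> (\<exists>b. b ^ 2 = a)"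

end

theory Submission
  imports Defs
begin

text \<open>Both groups are cut out of the \<open>2 \<times> 2\<close> matrices by a condition on the determinant, so having a
  square root in the group is a property of the similarity class, and \<open>A\<close> may be replaced by the
  diagonal matrix \<open>diag(l1, l2)\<close>.

  If a matrix with rows \<open>(x, y)\<close> and \<open>(z, w)\<close> squares to a diagonal matrix, then
  \<open>y (x + w) = z (x + w) = 0\<close>, and the two diagonal entries of the square differ by \<open>(x - w) (x + w)\<close>.
  When \<open>l1 \<noteq> l2\<close> this forces \<open>x + w \<noteq> 0\<close>, so the root is itself diagonal and its entries
  are square roots of \<open>l1\<close> and \<open>l2\<close>. (For \<open>l1 = l2\<close> this fails: the rotation with rows \<open>(0, -1)\<close> and
  \<open>(1, 0)\<close> has square \<open>-1\<close> whether or not \<open>-1\<close> is a square in the field.)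

  Conversely, if \<open>l1 = b\<^sup>2\<close> and \<open>l2 = c\<^sup>2\<close> then \<open>diag(b, c)\<close> is a square root. In the special linear
  group \<open>(b c)\<^sup>2 = l1 l2 = 1\<close>, so \<open>b c\<close> is \<open>1\<close> or \<open>-1\<close>, and in the second case \<open>diag(-b, c)\<close> has
  determinant \<open>1\<close> and the same square.\<close>

section \<open>Diagonal two by two matrices\<close>

text \<open>The diagonal matrix is kept in the form in which a Jordan normal form with two blocks of size
  one presents it.\<close>

definition diag2 :: "'a :: zero_neq_one \<Rightarrow> 'a \<Rightarrow> 'a mat" where
  "diag2 a b = jordan_matrix [(1, a), (1, b)]"

lemma diag2_carrier [simp]: "diag2 a b \<in> carrier_mat 2 2"
  by (rule carrier_matI) (simp_all add: diag2_def numeral_2_eq_2)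

lemma diag2_dim [simp]: "dim_row (diag2 a b) = 2" "dim_col (diag2 a b) = 2"
  using diag2_carrier by blast+

lemma diag2_index:
  assumes "i < 2" "j < 2"
  shows "diag2 a b $$ (i, j) = (if i = j then if i = 0 then a else b else 0)"
  using assms by (auto simp: diag2_def jordan_matrix_def Let_def less_2_cases_iff)

lemma det_diag2: "det (diag2 a b) = a * (b :: 'a :: field)"
proof -
  have "upper_triangular (diag2 a b)"
    by (auto simp: diag2_index)
  from det_upper_triangular[OF this diag2_carrier]
  show ?thesis
    by (simp add: diag_mat_def numeral_2_eq_2 diag2_index[unfolded numeral_2_eq_2])
qed

lemma square_index_2x2:
  fixes B :: "'a :: field mat"
  assumes B: "B \<in> carrier_mat 2 2" and ij: "i < 2" "j < 2"
  shows "(B ^\<^sub>m 2) $$ (i, j) = B $$ (i, 0) * B $$ (0, j) + B $$ (i, 1) * B $$ (1, j)"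
proof -
  have "B ^\<^sub>m 2 = B * B"
    using B by (simp add: numeral_2_eq_2)
  then show ?thesis
    using B ij by (simp add: scalar_prod_def numeral_2_eq_2)
qed

lemma diag2_square: "diag2 b c ^\<^sub>m 2 = diag2 (b ^ 2) (c ^ 2 :: 'a :: field)"
proof (rule eq_matI)
  fix i j
  assume "i < dim_row (diag2 (b ^ 2) (c ^ 2))" "j < dim_col (diag2 (b ^ 2) (c ^ 2))"
  then have ij: "i < 2" "j < 2"
    by auto
  show "(diag2 b c ^\<^sub>m 2) $$ (i, j) = diag2 (b ^ 2) (c ^ 2) $$ (i, j)"
    unfolding square_index_2x2[OF diag2_carrier ij]
    using ij by (auto simp: diag2_index power2_eq_square less_2_cases_iff)
qed (use pow_carrier_mat[OF diag2_carrier] in auto)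

text \<open>The off-diagonal entries of the square are multiples of the trace \<open>x + w\<close> of the root, and so
  is the difference of its diagonal entries.\<close>

lemma square_eq_diag2_distinct:
  fixes a b :: "'a :: field"
  assumes B: "B \<in> carrier_mat 2 2" and sq: "B ^\<^sub>m 2 = diag2 a b" and "a \<noteq> b"
  shows "(B $$ (0, 0)) ^ 2 = a \<and> (B $$ (1, 1)) ^ 2 = b"
proof -
  define x y z w where "x = B $$ (0, 0)" "y = B $$ (0, 1)" "z = B $$ (1, 0)" "w = B $$ (1, 1)"
  note entry = square_index_2x2[OF B, unfolded sq]
  have a: "a = x * x + y * z" and off: "0 = x * y + y * w" and b: "b = z * y + w * w"
    using entry[of 0 0] entry[of 0 1] entry[of 1 1] by (simp_all add: diag2_index x_y_z_w_def)
  have "a - b = (x - w) * (x + w)"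
    using a b by (simp add: algebra_simps)
  with \<open>a \<noteq> b\<close> have "x + w \<noteq> 0"
    by auto
  moreover have "y * (x + w) = 0"
    using off by (simp add: algebra_simps)
  ultimately have "y = 0"
    by simp
  then show ?thesis
    using a b unfolding x_y_z_w_def[symmetric] by (simp add: power2_eq_square)
qed

section \<open>Square roots and similarity\<close>

lemma invertible_mat_iff_det:
  fixes A :: "'a :: field mat"
  assumes A: "A \<in> carrier_mat n n"
  shows "invertible_mat A \<longleftrightarrow> det A \<noteq> 0"
proof
  assume "invertible_mat A"
  then obtain B where AB: "A * B = 1\<^sub>m n" and BA: "B * A = 1\<^sub>m (dim_row B)"
    using A by (auto simp: invertible_mat_def inverts_mat_def)
  have "B \<in> carrier_mat n n"
    using arg_cong[OF AB, of dim_col] arg_cong[OF BA, of dim_col] A by auto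
  from det_mult[OF A this] AB show "det A \<noteq> 0"
    by auto
next
  assume "det A \<noteq> 0"
  from det_non_zero_imp_unit[OF A this]
  obtain B where "B \<in> carrier_mat n n" "A * B = 1\<^sub>m n" "B * A = 1\<^sub>m n"
    by (auto simp: Units_def ring_mat_def)
  then show "invertible_mat A"
    using A by (auto simp: invertible_mat_def inverts_mat_def)
qed

lemma GL2_eq_det: "(GL2 :: 'a :: field mat set) = {A \<in> carrier_mat 2 2. det A \<noteq> 0}"
  by (auto simp: GL2_def invertible_mat_iff_det)

text \<open>Conjugating a square root of \<open>A\<close> by the matrix that takes \<open>A\<close> to \<open>D\<close> gives a square root of \<open>D\<close>
  with the same determinant. A set \<open>S\<close> of admissible determinants covers both groups at once.\<close>

lemma has_square_root_in_similar:
  fixes A D :: "'a :: field mat"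
  assumes sim: "similar_mat A D" and A: "A \<in> carrier_mat n n"
    and root: "has_square_root_in {B \<in> carrier_mat n n. det B \<in> S} A"
  shows "has_square_root_in {B \<in> carrier_mat n n. det B \<in> S} D"
proof -
  obtain P Q where wit: "similar_mat_wit A D P Q"
    using sim by (auto simp: similar_mat_def)
  note w = similar_mat_witD2[OF A wit]
  obtain B where B: "B \<in> carrier_mat n n" "det B \<in> S" "B ^\<^sub>m 2 = A"
    using root by (auto simp: has_square_root_in_def)
  have witB: "similar_mat_wit (Q * B * P) B Q P"
    by (rule similar_mat_witI[of _ _ n]) (use w B in auto)
  have carrier: "Q * B * P \<in> carrier_mat n n"
    using w B by auto
  have "det (Q * B * P) = det B"
    using witB by (intro det_similar) (auto simp: similar_mat_def)
  moreover have "(Q * B * P) ^\<^sub>m 2 = D"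
  proof -
    have "(Q * B * P) ^\<^sub>m 2 = Q * B ^\<^sub>m 2 * P"
      using similar_mat_witD2(3)[OF _ similar_mat_wit_pow[OF witB]] carrier
      by blast
    also have "\<dots> = D"
      using similar_mat_witD2(3)[OF _ similar_mat_wit_sym[OF wit], of n n] w B by auto
    finally show ?thesis .
  qed
  ultimately show ?thesis
    using B carrier unfolding has_square_root_in_def by (intro bexI[of _ "Q * B * P"]) auto
qed

section \<open>Square roots of diagonal matrices\<close>

lemma has_square_root_in_SL2_diag2:
  fixes b c :: "'a :: field"
  assumes "b ^ 2 * c ^ 2 = 1"
  shows "has_square_root_in SL2 (diag2 (b ^ 2) (c ^ 2))"
proof -
  have "(b * c) ^ 2 = 1"
    using assms by (simp add: power_mult_distrib)
  then have "b * c = 1 \<or> (- b) * c = 1"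
    by (auto simp: power2_eq_1_iff)
  then obtain b' where "b' * c = 1" "b' ^ 2 = b ^ 2"
    by (metis power2_minus)
  then have "diag2 b' c \<in> SL2" "diag2 b' c ^\<^sub>m 2 = diag2 (b ^ 2) (c ^ 2)"
    by (simp_all only: SL2_def det_diag2 diag2_square mem_Collect_eq diag2_carrier)
  then show ?thesis
    unfolding has_square_root_in_def by blast
qed

lemma has_square_root_in_GL2_diag2:
  fixes b c :: "'a :: field"
  assumes "b \<noteq> 0" "c \<noteq> 0"
  shows "has_square_root_in GL2 (diag2 (b ^ 2) (c ^ 2))"
proof -
  have "diag2 b c \<in> GL2"
    using assms by (simp add: GL2_eq_det det_diag2)
  then show ?thesis
    unfolding has_square_root_in_def using diag2_square by blast
qed

theorem theorem30:
  fixes G :: "'p :: prime_card mod_ring mat set"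
    and A :: "'p mod_ring mat"
    and l1 l2 :: "'p mod_ring"
  assumes "G = SL2 \<or> G = GL2"
    and "A \<in> G"
    and "jordan_nf A [(1, l1), (1, l2)]"
  shows "(l1 \<noteq> l2 \<longrightarrow>
            (has_square_root_in G A \<longleftrightarrow> nonzero_square l1 \<and> nonzero_square l2))
       \<and> (nonzero_square l1 \<and> nonzero_square l2 \<longrightarrow> has_square_root_in G A)"
proof -
  let ?D = "diag2 l1 l2"
  obtain S where G: "G = {B \<in> carrier_mat 2 2. det B \<in> S}" and S: "0 \<notin> S"
  proof (cases "G = SL2")
    case True
    then show thesis
      by (intro that[of "{1}"]) (auto simp: SL2_def)
  next
    case False
    with assms(1) show thesis
      by (intro that[of "- {0}"]) (auto simp: GL2_eq_det)
  qed
  have A: "A \<in> carrier_mat 2 2"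
    using assms(2) G by simp
  have sim: "similar_mat A ?D"
    using assms(3) unfolding jordan_nf_def diag2_def by blast
  have root_iff: "has_square_root_in G A \<longleftrightarrow> has_square_root_in G ?D"
    using has_square_root_in_similar[OF sim A] diag2_carrier
      has_square_root_in_similar[OF similar_mat_sym[OF sim], of 2] unfolding G by blast
  have det: "det A = l1 * l2"
    using det_similar[OF sim] det_diag2 by metis
  have nonzero: "l1 \<noteq> 0" "l2 \<noteq> 0"
    using assms(2) G S det by auto
  have "nonzero_square l1 \<and> nonzero_square l2"
    if ne: "l1 \<noteq> l2" and root: "has_square_root_in G A"
  proof -
    obtain B where "B \<in> carrier_mat 2 2" "B ^\<^sub>m 2 = ?D"
      using root root_iff G by (auto simp: has_square_root_in_def)
    from square_eq_diag2_distinct[OF this ne] nonzero show ?thesis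
      unfolding nonzero_square_def by blast
  qed
  moreover have "has_square_root_in G A" if squares: "nonzero_square l1 \<and> nonzero_square l2"
  proof -
    obtain b c where b: "b ^ 2 = l1" and c: "c ^ 2 = l2"
      using squares unfolding nonzero_square_def by blast
    have "has_square_root_in G ?D"
      using assms(1)
    proof
      assume "G = SL2"
      moreover have "b ^ 2 * c ^ 2 = 1"
        using assms(2) \<open>G = SL2\<close> det unfolding b c by (simp add: SL2_def)
      ultimately show ?thesis
        using has_square_root_in_SL2_diag2[of b c] b c by simp
    next
      assume "G = GL2"
      moreover have "b \<noteq> 0" "c \<noteq> 0"
        using nonzero b c by auto
      ultimately show ?thesis
        using has_square_root_in_GL2_diag2[of b c] b c by simp
    qed
    then show ?thesis
      by (simp only: root_iff)
  qed
  ultimately show ?thesis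
    by blast
qed

end
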